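(* Let $\Gamma$ be a tree on the vertex set $[m+1]$, $m\ge 1$, and for $j=1,\dots,m+1$ let $v_j$ be the minor of $A(\Gamma)$ obtained by omitting the $j$th column of $A(\Gamma)$. Then $$v_j=\pm\prod_{1\le i\le m+1,\ i\neq j}x_{i\,b(i,j)}\qquad\text{for } j=1,2,\dots,m+1.$$
   Context: $[m+1]=\{1,\dots,m+1\}$. Let $K$ be a field, and for each edge $\{i,j\}$ of $\Gamma$ let $x_{ij}$ and $x_{ji}$ be two distinct indeterminates; all these indeterminates (two per edge) are distinct and we work in the polynomial ring over $K$ in them. Fix an arbitrary ordering of the $m$ edges of $\Gamma$. The $m\times(m+1)$ matrix $A(\Gamma)=(a_{kl})$ is defined as follows: if the $k$th edge is $\{i,j\}$ with $i<j$, then $a_{ki}=-x_{ij}$, $a_{kj}=x_{ji}$, and $a_{kl}=0$ for $l\ne i,j$. For distinct vertices $i,j$ of $\Gamma$, let $i=i_0,i_1,\dots,i_{k}=j$ be the unique path in $\Gamma$ from $i$ to $j$; set $b(i,j)=i_1$. *)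

theory Defs
  imports "HOL-Library.Poly_Mapping" "Jordan_Normal_Form.Determinant" "Jordan_Normal_Form.DL_Submatrix"
begin

text \<open>
  A simple graph is given by a finite vertex set \<open>V\<close> and a set \<open>E\<close> of 2-element subsets of \<open>V\<close>.
  The library notion of tree for digraphs is not suitable here: in a symmetric digraph every
  edge already yields a directed cycle of length two.
\<close>

definition simple_graph :: "nat set \<Rightarrow> nat set set \<Rightarrow> bool" where
  "simple_graph V E \<longleftrightarrow> finite V \<and> (\<forall>e\<in>E. e \<subseteq> V \<and> card e = 2)"

text \<open>A path \<open>i\<^sub>0, \<dots>, i\<^sub>k\<close> is encoded as the list of its (distinct) vertices; \<open>k = 0\<close> is allowed.\<close>

definition is_path :: "nat set \<Rightarrow> nat set set \<Rightarrow> nat \<Rightarrow> nat list \<Rightarrow> nat \<Rightarrow> bool" where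
  "is_path V E i p j \<longleftrightarrow> p \<noteq> [] \<and> set p \<subseteq> V \<and> hd p = i \<and> last p = j \<and> distinct p
     \<and> successively (\<lambda>u v. {u, v} \<in> E) p"

definition is_cycle :: "nat set set \<Rightarrow> nat list \<Rightarrow> bool" where
  "is_cycle E c \<longleftrightarrow> length c \<ge> 3 \<and> distinct c \<and> successively (\<lambda>u v. {u, v} \<in> E) c
     \<and> {last c, hd c} \<in> E"

definition is_tree :: "nat set \<Rightarrow> nat set set \<Rightarrow> bool" where
  "is_tree V E \<longleftrightarrow> simple_graph V E \<and> V \<noteq> {} \<and> (\<forall>i\<in>V. \<forall>j\<in>V. \<exists>p. is_path V E i p j)
     \<and> (\<nexists>c. is_cycle E c)"

text \<open>Only used for distinct vertices of a tree, where the path exists, is unique and has at least two vertices.\<close>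

definition tree_path :: "nat set \<Rightarrow> nat set set \<Rightarrow> nat \<Rightarrow> nat \<Rightarrow> nat list" where
  "tree_path V E i j = (THE p. is_path V E i p j)"

definition next_vertex :: "nat set \<Rightarrow> nat set set \<Rightarrow> nat \<Rightarrow> nat \<Rightarrow> nat" where
  "next_vertex V E i j = tree_path V E i j ! 1"

text \<open>
  Polynomials with coefficients in \<open>'k\<close> are finitely supported maps from monomials to
  coefficients, where a monomial is a finitely supported map from indeterminates to exponents.
  Indeterminates are indexed by all pairs of naturals; the polynomial ring in the indeterminates
  \<open>x\<^sub>i\<^sub>j, x\<^sub>j\<^sub>i\<close> of the edges \<open>{i, j}\<close> of a given graph is a subring of this ring.
\<close>

type_synonym 'k edge_poly = "(nat \<times> nat \<Rightarrow>\<^sub>0 nat) \<Rightarrow>\<^sub>0 'k"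

definition xvar :: "nat \<Rightarrow> nat \<Rightarrow> 'k::field edge_poly" where
  "xvar i j = Poly_Mapping.single (Poly_Mapping.single (i, j) 1) 1"

text \<open>
  The list \<open>es\<close> is the chosen ordering of the edges. Matrix indices start at 0, so the \<open>k\<close>-th row
  belongs to the edge \<open>es ! k\<close> and the \<open>l\<close>-th column to the vertex \<open>l + 1\<close>.
\<close>

definition tree_matrix :: "nat \<Rightarrow> nat set list \<Rightarrow> 'k::field edge_poly mat" where
  "tree_matrix m es = mat m (m + 1) (\<lambda>(k, l).
     let i = Min (es ! k); j = Max (es ! k) in
       if l + 1 = i then - xvar i j
       else if l + 1 = j then xvar j i
       else 0)"

definition column_minor :: "'a::comm_ring_1 mat \<Rightarrow> nat \<Rightarrow> 'a" where
  "column_minor A c = det (submatrix A UNIV (- {c}))"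

end

theory Submission
  imports Defs
begin

text \<open>
  Fix the omitted vertex \<open>j\<close> and regard it as the root of the tree; then \<open>b(i, j)\<close> is the parent
  of \<open>i\<close>. Sending every vertex \<open>i \<noteq> j\<close> to the edge joining it to its parent is a bijection onto
  the edges (\<open>bij_betw_parent_edge\<close>), so the tree has \<open>m\<close> edges and the minor is the determinant of
  a square matrix whose columns are the vertices other than \<open>j\<close>.

  An entry of this matrix is nonzero only if the vertex of the column lies on the edge of the row.
  A nonvanishing term of the Leibniz expansion therefore selects for each vertex \<open>i \<noteq> j\<close> an edge
  containing \<open>i\<close>, different vertices receiving different edges. Such a selection must be the
  parent edge bijection (\<open>injective_incident_edges_are_parent_edges\<close>): a deepest vertex that
  selects another edge would select the parent edge of one of its children, but that child, being
  deeper, has selected this edge already. So the expansion has exactly one nonvanishing term,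
  namely, up to sign, the product of the entries \<open>x\<^bsub>i b(i, j)\<^esub>\<close>.
\<close>

section \<open>Paths in trees\<close>

lemma is_path_Cons_iff:
  "is_path V E i (x # p) j \<longleftrightarrow>
     x = i \<and> i \<in> V \<and> (if p = [] then i = j else i \<notin> set p \<and> {i, hd p} \<in> E \<and> is_path V E (hd p) p j)"
  by (auto simp: is_path_def successively_Cons)

lemma is_path_append_right:
  assumes "is_path V E i (a @ x # q) j"
  shows "is_path V E x (x # q) j"
  using assms by (auto simp: is_path_def successively_append_iff)

text \<open>
  After their common beginning is removed, two different paths leave \<open>i\<close> along different edges.
  Following the first one up to the first vertex that it shares with the second, and returning
  along the second, gives a cycle.
\<close>

lemma is_path_unique_if_no_cycle:
  assumes "\<nexists>c. is_cycle E c" "is_path V E i p j" "is_path V E i q j"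
  shows "p = q"
  using assms(2,3)
proof (induction p arbitrary: i q)
  case Nil
  then show ?case by (simp add: is_path_def)
next
  case (Cons x p)
  obtain q' where q: "q = i # q'"
    using Cons.prems(2) by (cases q) (auto simp: is_path_def)
  have x: "x = i" using Cons.prems(1) by (simp add: is_path_Cons_iff)
  consider "p = [] \<or> q' = []" | "p \<noteq> []" "q' \<noteq> []" "hd p = hd q'"
    | "p \<noteq> []" "q' \<noteq> []" "hd p \<noteq> hd q'" by blast
  then show ?case
  proof cases
    case 1
    then show ?thesis
      using Cons.prems x q by (auto simp: is_path_def split: if_splits)
  next
    case 2
    then have "is_path V E (hd p) p j" "is_path V E (hd p) q' j"
      using Cons.prems q by (simp_all add: is_path_Cons_iff)
    then show ?thesis using Cons.IH x q by blast
  next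
    case 3
    have P: "is_path V E (hd p) p j" "i \<notin> set p" "{i, hd p} \<in> E"
      and Q: "is_path V E (hd q') q' j" "i \<notin> set q'" "{i, hd q'} \<in> E"
      using Cons.prems q 3 by (simp_all add: is_path_Cons_iff)
    have "j \<in> set p" "j \<in> set q'"
      using P(1) Q(1) unfolding is_path_def by (metis last_in_set)+
    then have "\<exists>y\<in>set p. y \<in> set q'" by blast
    then obtain a y p2 where a: "p = a @ y # p2" "y \<in> set q'" "\<forall>z\<in>set a. z \<notin> set q'"
      by (rule split_list_first_propE)
    obtain b q2 where b: "q' = b @ y # q2" using a(2) by (meson split_list)
    have ne: "a \<noteq> [] \<or> b \<noteq> []" using 3(3) a(1) b by auto
    let ?R = "\<lambda>u v. {u, v} \<in> E"
    let ?c = "i # a @ y # rev b"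
    have sa: "successively ?R (a @ [y])" and sb: "successively ?R (b @ [y])"
      using P(1) Q(1) a(1) b by (auto simp: is_path_def successively_append_iff)
    have "successively ?R (rev (b @ [y]))"
      unfolding successively_rev using sb by (simp add: insert_commute)
    then have "successively ?R (a @ y # rev b)"
      using sa by (simp add: successively_append_iff)
    moreover have "hd (a @ y # rev b) = hd p" by (cases a) (simp_all add: a(1))
    ultimately have "successively ?R ?c"
      using P(3) by (simp add: successively_Cons)
    moreover have "last ?c = hd q'" by (cases b) (simp_all add: b)
    moreover have "distinct ?c"
      using P Q a b by (auto simp: is_path_def)
    moreover have "length ?c \<ge> 3" using ne by (cases a; cases b) auto
    ultimately have "is_cycle E ?c"
      using Q(3) by (simp add: is_cycle_def insert_commute)
    then show ?thesis using assms(1) by blast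
  qed
qed

lemma is_tree_edge:
  assumes "is_tree V E" "e \<in> E" "u \<in> e"
  obtains w where "e = {u, w}" "u \<in> V" "w \<in> V" "w \<noteq> u"
proof -
  have e: "e \<subseteq> V" "card e = 2"
    using assms(1,2) by (simp_all add: is_tree_def simple_graph_def)
  then have "card (e - {u}) = 1" using assms(3) by simp
  then obtain w where "e - {u} = {w}" by (rule card_1_singletonE)
  then have "e = {u, w}" "w \<noteq> u" using assms(3) by auto
  then show thesis using that e(1) by simp
qed

lemma is_tree_path:
  assumes "is_tree V E" "i \<in> V" "j \<in> V"
  obtains p where "is_path V E i p j"
  using assms unfolding is_tree_def by blast

lemma tree_path_eq:
  assumes "is_tree V E" "is_path V E i p j"
  shows "tree_path V E i j = p"
  unfolding tree_path_def
proof (rule the_equality[where a = p])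
  show "q = p" if "is_path V E i q j" for q
    using is_path_unique_if_no_cycle that assms by (meson is_tree_def)
qed (rule assms(2))

lemma next_vertex_eq:
  assumes "is_tree V E" "is_path V E i (i # y # q) j"
  shows "next_vertex V E i j = y"
  using tree_path_eq[OF assms] by (simp add: next_vertex_def)

section \<open>The tree rooted at a vertex\<close>

lemma next_vertex_step:
  assumes "is_tree V E" "i \<in> V" "j \<in> V" "i \<noteq> j"
  shows "{i, next_vertex V E i j} \<in> E"
    and "length (tree_path V E i j) = Suc (length (tree_path V E (next_vertex V E i j) j))"
proof -
  obtain p where p: "is_path V E i p j" using assms by (auto elim: is_tree_path)
  then obtain y q where pe: "p = i # y # q"
    using assms(4) by (cases p; cases "tl p") (auto simp: is_path_def)
  have y: "is_path V E y (y # q) j" and e: "{i, y} \<in> E"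
    using p unfolding pe is_path_Cons_iff[of V E i] by auto
  have n: "next_vertex V E i j = y"
    using next_vertex_eq[OF assms(1)] p pe by blast
  show "{i, next_vertex V E i j} \<in> E" using e n by simp
  show "length (tree_path V E i j) = Suc (length (tree_path V E (next_vertex V E i j) j))"
    using tree_path_eq[OF assms(1) p] tree_path_eq[OF assms(1) y] n pe by simp
qed

text \<open>
  The path from one end \<open>u\<close> of an edge to the root either avoids the other end \<open>w\<close>, and then
  extends to the path from \<open>w\<close>; or it contains \<open>w\<close>, and then uniqueness of paths forces \<open>w\<close> to be
  its second vertex.
\<close>

lemma tree_edge_cases:
  assumes "is_tree V E" "j \<in> V" "{u, w} \<in> E"
  obtains "u \<noteq> j" "next_vertex V E u j = w" | "w \<noteq> j" "next_vertex V E w j = u"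
proof -
  have uw: "u \<in> V" "w \<in> V" "u \<noteq> w"
    using is_tree_edge[OF assms(1,3), of u] by auto
  obtain p where p: "is_path V E u p j" using assms uw by (auto elim: is_tree_path)
  then obtain p' where pe: "p = u # p'" by (cases p) (auto simp: is_path_def)
  have jp: "j \<in> set p" using p by (auto simp: is_path_def)
  show thesis
  proof (cases "w \<in> set p")
    case False
    then have "is_path V E w (w # u # p') j"
      using p uw assms(3) unfolding pe is_path_Cons_iff[of V E w] by (auto simp: insert_commute)
    then have "next_vertex V E w j = u" by (rule next_vertex_eq[OF assms(1)])
    then show thesis using that(2) False jp by blast
  next
    case True
    then obtain a q where a: "p' = a @ w # q"
      using uw pe by (auto dest: split_list)
    have q: "is_path V E w (w # q) j"
      using p is_path_append_right[of V E u "u # a" w q j] by (simp add: pe a)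
    have "u \<notin> set (w # q)" using p by (auto simp: is_path_def pe a)
    then have "is_path V E u (u # w # q) j"
      using q uw assms(3) unfolding is_path_Cons_iff[of V E u] by auto
    then have "next_vertex V E u j = w" by (rule next_vertex_eq[OF assms(1)])
    moreover have "u \<noteq> j"
      using q \<open>u \<notin> set (w # q)\<close> by (metis is_path_def last_in_set)
    ultimately show thesis using that(1) by blast
  qed
qed

text \<open>
  Every edge is the parent edge of one of its ends by the preceding lemma, and not of both, since
  a parent is closer to the root than its child.
\<close>

lemma bij_betw_parent_edge:
  assumes "is_tree V E" "j \<in> V"
  shows "bij_betw (\<lambda>i. {i, next_vertex V E i j}) (V - {j}) E"
  unfolding bij_betw_def
proof
  show "inj_on (\<lambda>i. {i, next_vertex V E i j}) (V - {j})"
  proof (rule inj_onI, rule ccontr)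
    fix i k
    assume ik: "i \<in> V - {j}" "k \<in> V - {j}" "i \<noteq> k"
      "{i, next_vertex V E i j} = {k, next_vertex V E k j}"
    then have "next_vertex V E i j = k" "next_vertex V E k j = i"
      by (auto simp: doubleton_eq_iff)
    then show False
      using next_vertex_step(2)[of V E i j] next_vertex_step(2)[of V E k j] ik assms by auto
  qed
next
  show "(\<lambda>i. {i, next_vertex V E i j}) ` (V - {j}) = E"
  proof (intro equalityI subsetI)
    fix e assume "e \<in> (\<lambda>i. {i, next_vertex V E i j}) ` (V - {j})"
    then show "e \<in> E" using next_vertex_step(1)[of V E _ j] assms by auto
  next
    fix e assume e: "e \<in> E"
    moreover have "e \<noteq> {}"
      using e assms(1) by (auto simp: is_tree_def simple_graph_def)
    ultimately obtain u w where uw: "e = {u, w}" "u \<in> V" "w \<in> V"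
      using is_tree_edge[OF assms(1)] by (metis all_not_in_conv)
    have "{u, w} \<in> E" using e uw by simp
    with assms show "e \<in> (\<lambda>i. {i, next_vertex V E i j}) ` (V - {j})"
      by (rule tree_edge_cases) (use uw in \<open>auto simp: insert_commute\<close>)
  qed
qed

text \<open>
  This is why only one Leibniz term survives. If \<open>i\<close> is assigned the edge to one of its children,
  the child has to be assigned some other edge; so a deepest vertex with an edge other than its
  parent edge cannot exist.
\<close>

lemma injective_incident_edges_are_parent_edges:
  assumes T: "is_tree V E" "j \<in> V"
    and inj: "inj_on g (V - {j})"
    and edge: "\<And>i. i \<in> V - {j} \<Longrightarrow> g i \<in> E"
    and incident: "\<And>i. i \<in> V - {j} \<Longrightarrow> i \<in> g i"
    and i: "i \<in> V - {j}"
  shows "g i = {i, next_vertex V E i j}"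
proof (rule ccontr)
  assume neq: "g i \<noteq> {i, next_vertex V E i j}"
  define B where "B = {k \<in> V - {j}. g k \<noteq> {k, next_vertex V E k j}}"
  define d where "d k = length (tree_path V E k j)" for k
  have "finite B" "B \<noteq> {}"
    using T(1) i neq by (auto simp: B_def is_tree_def simple_graph_def)
  then obtain k where k: "k \<in> B" "d k = Max (d ` B)"
    using Max_in[of "d ` B"] by fastforce
  have deepest: "d y \<le> d k" if "y \<in> B" for y
    using that k \<open>finite B\<close> by simp
  have kV: "k \<in> V - {j}" and k_neq: "g k \<noteq> {k, next_vertex V E k j}"
    using k(1) by (auto simp: B_def)
  obtain y where y: "g k = {k, y}" "y \<in> V" "y \<noteq> k"
    using is_tree_edge[OF T(1) edge[OF kV] incident[OF kV]] by blast
  have "{k, y} \<in> E" using edge[OF kV] y by simp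
  with T have child: "y \<noteq> j \<and> next_vertex V E y j = k"
    by (rule tree_edge_cases) (use k_neq y(1) in auto)
  then have "d y = Suc (d k)"
    using next_vertex_step(2)[OF T(1) y(2) T(2)] by (simp add: d_def)
  then have "y \<notin> B" using deepest[of y] by linarith
  then have "g y = g k"
    using y child by (auto simp: B_def insert_commute)
  then show False using inj kV y child by (auto dest: inj_onD)
qed

section \<open>Determinants with a single Leibniz term\<close>

lemma det_single_term:
  fixes M :: "'a::comm_ring_1 mat"
  assumes M: "M \<in> carrier_mat n n" and p: "p permutes {0..<n}"
    and zero: "\<And>q. q permutes {0..<n} \<Longrightarrow> q \<noteq> p \<Longrightarrow> \<exists>c<n. M $$ (q c, c) = 0"
  shows "det M = signof p * (\<Prod>c<n. M $$ (p c, c))"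
proof -
  have "det M = (\<Sum>q | q permutes {0..<n}. if q = p then signof p * (\<Prod>c<n. M $$ (p c, c)) else 0)"
    unfolding det_col[OF M]
  proof (rule sum.cong[OF refl])
    fix q assume "q \<in> {q. q permutes {0..<n}}"
    then show "signof q * (\<Prod>c<n. M $$ (q c, c)) =
        (if q = p then signof p * (\<Prod>c<n. M $$ (p c, c)) else 0)"
      using zero[of q] prod_zero[of "{..<n}" "\<lambda>c. M $$ (q c, c)"] by fastforce
  qed
  also have "\<dots> = signof p * (\<Prod>c<n. M $$ (p c, c))"
    using p by (simp add: finite_permutations sum.delta)
  finally show ?thesis .
qed

lemma prod_eq_up_to_sign:
  fixes f g :: "'b \<Rightarrow> 'a::comm_ring_1"
  assumes "\<And>i. i \<in> A \<Longrightarrow> f i = g i \<or> f i = - g i"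
  shows "prod f A = prod g A \<or> prod f A = - prod g A"
  using assms
proof (induction A rule: infinite_finite_induct)
  case (insert x A)
  then have "f x = g x \<or> f x = - g x" "prod f A = prod g A \<or> prod f A = - prod g A" by auto
  then show ?case using insert.hyps by auto
qed auto

section \<open>The minors of the matrix of a tree\<close>

lemma card_remove_one:
  assumes "c \<le> m"
  shows "card {a. a < Suc m \<and> a \<in> - {c}} = m"
proof -
  have "{a. a < Suc m \<and> a \<in> - {c}} = {..m} - {c}" by auto
  then show ?thesis using assms by simp
qed

lemma bij_betw_pick_remove:
  assumes "c \<le> m"
  shows "bij_betw (pick (- {c})) {..<m} ({..m} - {c})"
proof -
  have inf: "infinite (- {c})" by simp
  have inj: "inj_on (pick (- {c})) {..<m}"
    by (rule inj_onI, rule iffD2[OF pick_eq_iff_inf[OF inf]])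
  have "pick (- {c}) ` {..<m} = {..m} - {c}"
  proof (rule card_subset_eq)
    have "pick (- {c}) k \<in> {..m} - {c}" if "k < m" for k
      using pick_in_set_inf[OF inf, of k] pick_le[of k "Suc m" "- {c}"] that
        card_remove_one[OF assms] by auto
    then show "pick (- {c}) ` {..<m} \<subseteq> {..m} - {c}" by (auto simp del: Diff_iff)
    show "card (pick (- {c}) ` {..<m}) = card ({..m} - {c})"
      using assms by (simp add: card_image[OF inj])
  qed simp
  with inj show ?thesis by (simp add: bij_betw_def)
qed

lemma tree_matrix_not_incident:
  assumes "k < m" "l \<le> m" "finite (es ! k)" "Suc l \<notin> es ! k" "es ! k \<noteq> {}"
  shows "tree_matrix m es $$ (k, l) = 0"
proof -
  have "Min (es ! k) \<in> es ! k" "Max (es ! k) \<in> es ! k"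
    by (intro Min_in Max_in assms)+
  then have "Suc l \<noteq> Min (es ! k)" "Suc l \<noteq> Max (es ! k)"
    using assms(4) by metis+
  then show ?thesis
    using assms(1,2) by (simp add: tree_matrix_def)
qed

lemma tree_matrix_incident:
  assumes "k < m" "l \<le> m" "es ! k = {Suc l, y}" "y \<noteq> Suc l"
  shows "tree_matrix m es $$ (k, l) = xvar (Suc l) y \<or> tree_matrix m es $$ (k, l) = - xvar (Suc l) y"
proof (cases "Suc l < y")
  case True
  then show ?thesis using assms by (simp add: tree_matrix_def)
next
  case False
  then have "y < Suc l" using assms(4) by simp
  then show ?thesis using assms by (simp add: tree_matrix_def)
qed

theorem proposition1p2:
  fixes m :: nat and E :: "nat set set" and es :: "nat set list" and v :: "nat \<Rightarrow> 'k::field edge_poly"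
  assumes "m \<ge> 1"
    and "is_tree {1..m+1} E"
    and "distinct es" and "set es = E"
    and "\<And>j. j \<in> {1..m+1} \<Longrightarrow> v j = column_minor (tree_matrix m es) (j - 1)"
  shows "\<forall>j\<in>{1..m+1}.
      v j = (\<Prod>i\<in>{1..m+1} - {j}. xvar i (next_vertex {1..m+1} E i j)) \<or>
      v j = - (\<Prod>i\<in>{1..m+1} - {j}. xvar i (next_vertex {1..m+1} E i j))"
proof
  fix j assume j: "j \<in> {1..m+1}"
  define V where "V = {1..m+1}"
  define par where "par i = next_vertex V E i j" for i
  define M where "M = submatrix (tree_matrix m es :: 'k edge_poly mat) UNIV (- {j - 1})"
  \<comment> \<open>The vertex to which a column of the minor belongs: \<open>pick\<close> recovers the column of the
     full matrix, and the successor accounts for columns starting at 0 and vertices at 1.\<close>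
  define vtx where "vtx c = Suc (pick (- {j - 1}) c)" for c
  have T: "is_tree V E" "j \<in> V" using assms(2) j by (simp_all add: V_def)
  have edge2: "card e = 2" if "e \<in> E" for e
    using that T(1) by (simp add: is_tree_def simple_graph_def)

  have parent_edges: "bij_betw (\<lambda>i. {i, par i}) (V - {j}) E"
    unfolding par_def by (rule bij_betw_parent_edge[OF T])
  have len: "length es = m"
    using bij_betw_same_card[OF parent_edges] distinct_card[OF assms(3)] assms(4) j
    by (simp add: V_def)
  have rows: "bij_betw ((!) es) {..<m} E"
    using bij_betw_nth[OF assms(3), of "{..<m}" E] len assms(4) by simp
  have shift: "bij_betw Suc ({..m} - {j - 1}) (V - {j})"
    by (rule bij_betw_byWitness[where f' = "\<lambda>i. i - 1"]) (use j in \<open>auto simp: V_def\<close>)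
  have cols: "bij_betw vtx {..<m} (V - {j})"
  proof -
    have "bij_betw (Suc \<circ> pick (- {j - 1})) {..<m} (V - {j})"
      by (rule bij_betw_trans[OF bij_betw_pick_remove shift]) (use j in auto)
    then show ?thesis by (simp add: vtx_def[abs_def] comp_def)
  qed
  have vtx: "vtx c \<in> V - {j}" if "c < m" for c
    using bij_betwE[OF cols] that by simp

  have card_cols: "card {a. a < Suc m \<and> a \<in> - {j - 1}} = m"
    by (rule card_remove_one) (use j in auto)
  have dims: "dim_row (tree_matrix m es) = m" "dim_col (tree_matrix m es) = Suc m"
    by (simp_all add: tree_matrix_def)
  have M: "M \<in> carrier_mat m m"
    using card_cols by (auto simp: M_def dim_submatrix dims)
  have entry: "M $$ (k, c) = tree_matrix m es $$ (k, vtx c - 1)" if "k < m" "c < m" for k c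
    using that card_cols unfolding M_def
    by (subst submatrix_index) (simp_all add: dims pick_UNIV vtx_def)

  \<comment> \<open>The surviving permutation sends a column to the row of the parent edge of its vertex.\<close>
  define row where "row = inv_into {..<m} ((!) es)"
  define p where "p c = (if c < m then row {vtx c, par (vtx c)} else c)" for c
  have nth_row: "es ! row e = e" "row e < m" if "e \<in> E" for e
    using that bij_betw_inv_into_right[OF rows] bij_betwE[OF bij_betw_inv_into[OF rows]]
    by (simp_all add: row_def)
  have p_edge: "{vtx c, par (vtx c)} \<in> E" if "c < m" for c
    using bij_betwE[OF parent_edges] vtx[OF that] by blast
  have "bij_betw (row \<circ> ((\<lambda>i. {i, par i}) \<circ> vtx)) {..<m} {..<m}"
    unfolding row_def
    by (rule bij_betw_trans[OF bij_betw_trans[OF cols parent_edges] bij_betw_inv_into[OF rows]])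
  moreover have "bij_betw p {..<m} {..<m} \<longleftrightarrow>
      bij_betw (row \<circ> ((\<lambda>i. {i, par i}) \<circ> vtx)) {..<m} {..<m}"
    by (rule bij_betw_cong) (simp add: p_def)
  ultimately have "bij_betw p {0..<m} {0..<m}"
    by (simp only: lessThan_atLeast0)
  then have p: "p permutes {0..<m}"
    by (rule bij_imp_permutes) (simp add: p_def)

  have "det M = signof p * (\<Prod>c<m. M $$ (p c, c))"
  proof (rule det_single_term[OF M p], rule ccontr)
    fix q assume q: "q permutes {0..<m}" "q \<noteq> p" and "\<not> (\<exists>c<m. M $$ (q c, c) = 0)"
    then have nz: "M $$ (q c, c) \<noteq> 0" if "c < m" for c using that by blast
    have qm: "q c < m" if "c < m" for c
      using permutes_in_image[OF q(1), of c] that by simp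
    define col where "col = inv_into {..<m} vtx"
    have col: "col i < m" "vtx (col i) = i" if "i \<in> V - {j}" for i
      using that bij_betw_inv_into_right[OF cols] bij_betwE[OF bij_betw_inv_into[OF cols]]
      by (simp_all add: col_def)
    \<comment> \<open>The edge that the permutation \<open>q\<close> selects for a vertex.\<close>
    define g where "g i = es ! q (col i)" for i
    have gE: "g i \<in> E" if "i \<in> V - {j}" for i
      using bij_betwE[OF rows] qm[OF col(1)[OF that]] by (simp add: g_def)
    have g_inc: "i \<in> g i" if i: "i \<in> V - {j}" for i
    proof (rule ccontr)
      assume "i \<notin> g i"
      moreover have "finite (g i)" "g i \<noteq> {}"
        using edge2[OF gE[OF i]] by (auto intro: card_ge_0_finite)
      ultimately have "tree_matrix m es $$ (q (col i), i - 1) = (0 :: 'k edge_poly)"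
        using i qm[OF col(1)[OF i]] by (intro tree_matrix_not_incident) (auto simp: g_def V_def)
      then show False
        using nz[OF col(1)[OF i]] entry[OF qm[OF col(1)[OF i]] col(1)[OF i]] col(2)[OF i] by simp
    qed
    have g_inj: "inj_on g (V - {j})"
    proof (rule inj_onI)
      fix i k assume ik: "i \<in> V - {j}" "k \<in> V - {j}" "g i = g k"
      then have "q (col i) = q (col k)"
        using bij_betw_imp_inj_on[OF rows] qm col(1) by (auto simp: g_def inj_on_def)
      then have "col i = col k" using permutes_inj[OF q(1)] by (auto dest: injD)
      then show "i = k" using col(2) ik by metis
    qed
    have g: "g i = {i, par i}" if "i \<in> V - {j}" for i
      unfolding par_def
      by (rule injective_incident_edges_are_parent_edges[OF T g_inj gE g_inc that])
    have "q c = p c" for c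
    proof (cases "c < m")
      case True
      have "col (vtx c) = c"
        using bij_betw_inv_into_left[OF cols] True by (simp add: col_def)
      then have "es ! q c = {vtx c, par (vtx c)}"
        using g[OF vtx[OF True]] by (simp add: g_def)
      then have "row {vtx c, par (vtx c)} = q c"
        using bij_betw_inv_into_left[OF rows, of "q c"] qm[OF True] by (simp add: row_def)
      then show ?thesis using True by (simp add: p_def)
    next
      case False
      then show ?thesis using q(1) by (simp add: permutes_def p_def)
    qed
    then show False using q(2) by blast
  qed
  then have "det M = (\<Prod>c<m. M $$ (p c, c)) \<or> det M = - (\<Prod>c<m. M $$ (p c, c))"
    by (cases "evenperm p") (simp_all add: sign_def)
  moreover have "(\<Prod>c<m. M $$ (p c, c)) = (\<Prod>c<m. xvar (vtx c) (par (vtx c))) \<or>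
      (\<Prod>c<m. M $$ (p c, c)) = - (\<Prod>c<m. xvar (vtx c) (par (vtx c)))"
  proof (rule prod_eq_up_to_sign)
    fix c assume "c \<in> {..<m}"
    then have c: "c < m" by simp
    have pc: "p c < m" "es ! p c = {vtx c, par (vtx c)}"
      using nth_row[OF p_edge[OF c]] c by (simp_all add: p_def)
    have "par (vtx c) \<noteq> vtx c" using edge2[OF p_edge[OF c]] by auto
    moreover have "Suc (vtx c - 1) = vtx c" "vtx c - 1 \<le> m"
      using vtx[OF c] by (auto simp: V_def)
    ultimately show "M $$ (p c, c) = xvar (vtx c) (par (vtx c)) \<or>
        M $$ (p c, c) = - xvar (vtx c) (par (vtx c))"
      using tree_matrix_incident[of "p c" m "vtx c - 1" es "par (vtx c)"] pc entry[OF pc(1) c]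
      by simp
  qed
  moreover have "(\<Prod>c<m. xvar (vtx c) (par (vtx c))) = (\<Prod>i\<in>V - {j}. xvar i (par i) :: 'k edge_poly)"
    by (rule prod.reindex_bij_betw[OF cols])
  moreover have "v j = det M"
    using assms(5)[OF j] by (simp add: column_minor_def M_def)
  ultimately show "v j = (\<Prod>i\<in>{1..m+1} - {j}. xvar i (next_vertex {1..m+1} E i j)) \<or>
      v j = - (\<Prod>i\<in>{1..m+1} - {j}. xvar i (next_vertex {1..m+1} E i j))"
    unfolding par_def V_def by auto
qed

end
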